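(* Let $m\ge1$ and $n\ge1$ be integers. On the set $\mathcal{PK}_m(n)$ of parking distributions on the $m$-regular caterpillar tree $\mathrm{Cat}_m(n)$, the number $\mathrm{luck}$ of lucky drivers and the number $\omega_1$ of drivers that prefer to park at node $1$ have a symmetric joint distribution: for all integers $a,b$, $$|\{\mathbf{p}\in\mathcal{PK}_m(n):\mathrm{luck}(\mathbf{p})=a,\ \omega_1(\mathbf{p})=b\}|=|\{\mathbf{p}\in\mathcal{PK}_m(n):\mathrm{luck}(\mathbf{p})=b,\ \omega_1(\mathbf{p})=a\}|.$$ In fact, with $\mathbf{u}=(1,m+1,2m+1,\dots)$ and $$\gamma_n^{(m)}(q,t,1,1)=\sum_{\mathbf{p}\in\mathcal{PK}(n;\mathbf{u})}q^{\mathrm{luck}(\mathbf{p})}t^{\omega_1(\mathbf{p})},$$ the polynomial $\gamma_n^{(m)}(q,t,1,1)/(qt)$ is a linear combination of the complete homogeneous symmetric polynomials $h_k(q,t)$, $k\ge0$.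
   Context: $\mathrm{Cat}_m(n)$: the rooted tree with backbone a directed path $v_1\to v_2\to\cdots\to v_n$, with sink (root) $v_n$, where $v_2$ has $m$ leaves attached including $v_1$, and each $v_i$ with $i\ge3$ has $m-1$ additional leaves attached (all edges directed towards the sink; for $n=1$ the tree is a single vertex). It has $mn-m+1$ vertices, labelled $1,\dots,mn-m+1$ so that deeper vertices get smaller labels and, at equal depth, vertices of larger in-degree get smaller labels, with $v_1$ labelled $1$; thus the backbone vertex $v_i$ has label $m(i-1)+1$. A parking distribution on $\mathrm{Cat}_m(n)$ is a weakly increasing sequence of $mn-m+1$ preferred vertices (labels) such that all cars can park, where cars arrive in the order of the sequence, each goes to its preferred vertex and, if it is occupied, moves along the edges towards the sink until it finds an unoccupied vertex (leaving unparked if none is found). Equivalently, for every vertex $k$ the number of cars preferring a vertex in the subtree $T_k$ rooted at $k$ is at least $|T_k|$. $\mathcal{PK}_m(n)$ is the set of all of these. For $\mathbf{p}\in\mathcal{PK}_m(n)$, a car is lucky if it prefers a backbone vertex and parks at that vertex; $\mathrm{luck}(\mathbf{p})$ is the number of lucky cars, and $\omega_1(\mathbf{p})$ the number of cars preferring node $1$. $\mathcal{PK}(n;\mathbf{u})$ for $\mathbf{u}=(1,m+1,2m+1,\dots)$ is the set of weakly increasing sequences of positive integers $(p_1,\dots,p_n)$ with $p_i\le m(i-1)+1$ for all $i$; on it, $\mathrm{luck}(\mathbf{p})=|\{i:p_i=mi-m+1\}|$ and $\omega_1(\mathbf{p})=|\{i:p_i=1\}|$. $h_k(q,t)=\sum_{s=0}^k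 q^{k-s}t^s$. *)

theory Defs
  imports "HOL-Computational_Algebra.Polynomial"
begin

section \<open>Parking on a rooted tree\<close>

text \<open>
  A rooted tree is given by its parent map, which is \<open>None\<close> exactly at the sink.  The result of
  \<open>parking_spot par S v\<close> is the vertex where a car preferring \<open>v\<close> parks when the vertices in \<open>S\<close>
  are occupied, and \<open>None\<close> if the car runs past the sink.
\<close>

partial_function (option) parking_spot ::
  "('v \<Rightarrow> 'v option) \<Rightarrow> 'v set \<Rightarrow> 'v \<Rightarrow> 'v option" where
  "parking_spot par S v =
     (if v \<notin> S then Some v else Option.bind (par v) (\<lambda>u. parking_spot par S u))"

fun parking_outcome ::
  "('v \<Rightarrow> 'v option) \<Rightarrow> 'v set \<Rightarrow> 'v list \<Rightarrow> 'v option list" where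
  "parking_outcome par S [] = []"
| "parking_outcome par S (p # ps) =
     (let w = parking_spot par S p in w # parking_outcome par (S \<union> set_option w) ps)"


section \<open>The caterpillar tree\<close>

definition cat_size :: "nat \<Rightarrow> nat \<Rightarrow> nat" where
  "cat_size m n = m * n - m + 1"

text \<open>The label of the backbone vertex \<open>v\<^sub>i\<close>, for \<open>i \<ge> 1\<close>.\<close>

definition backbone :: "nat \<Rightarrow> nat \<Rightarrow> nat" where
  "backbone m i = m * (i - 1) + 1"

text \<open>
  The in-neighbours of \<open>v\<^sub>i\<close>, for \<open>2 \<le> i \<le> n\<close>, are the vertices one level deeper: \<open>v\<^sub>i\<^sub>-\<^sub>1\<close> and
  \<open>m - 1\<close> further leaves.  Labelling deeper vertices first, and the backbone vertex first within
  a level, gives them the labels \<open>m(i - 2) + 1, \<dots>, m(i - 1)\<close>, just below the label of \<open>v\<^sub>i\<close>; see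
  \<open>cat_parent_eq\<close>.
\<close>

definition cat_parent :: "nat \<Rightarrow> nat \<Rightarrow> nat \<Rightarrow> nat option" where
  "cat_parent m n k =
     (if k < cat_size m n then Some (m * ((k - 1) div m + 1) + 1) else None)"

lemma backbone_sink: "n \<ge> 1 \<Longrightarrow> backbone m n = cat_size m n"
  by (simp add: backbone_def cat_size_def diff_mult_distrib2)

lemma cat_parent_sink: "n \<ge> 1 \<Longrightarrow> cat_parent m n (backbone m n) = None"
  by (simp add: cat_parent_def backbone_sink)

lemma cat_parent_eq:
  assumes "1 \<le> i" "i < n" and k: "k \<in> {backbone m i..<backbone m (i + 1)}"
  shows "cat_parent m n k = Some (backbone m (i + 1))"
proof -
  have "m * (i - 1) \<le> k - 1" "k - 1 < m * Suc (i - 1)"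
    using k \<open>1 \<le> i\<close> by (auto simp: backbone_def)
  then have "(k - 1) div m = i - 1"
    by (metis div_nat_eqI)
  moreover have "m * i \<le> m * (n - 1)"
    using \<open>i < n\<close> by (intro mult_le_mono2) simp
  then have "k < cat_size m n"
    using k by (simp add: backbone_def cat_size_def diff_mult_distrib2)
  ultimately show ?thesis
    using \<open>1 \<le> i\<close> by (simp add: cat_parent_def backbone_def)
qed


section \<open>Parking distributions on the caterpillar tree\<close>

definition PK_cat :: "nat \<Rightarrow> nat \<Rightarrow> nat list set" where
  "PK_cat m n =
     {p. length p = cat_size m n \<and> sorted p \<and> set p \<subseteq> {1..cat_size m n} \<and>
         None \<notin> set (parking_outcome (cat_parent m n) {} p)}"

definition luck_cat :: "nat \<Rightarrow> nat \<Rightarrow> nat list \<Rightarrow> nat" where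
  "luck_cat m n p =
     card {i. i < length p \<and> p ! i \<in> backbone m ` {1..n} \<and>
              parking_outcome (cat_parent m n) {} p ! i = Some (p ! i)}"

definition omega1 :: "nat list \<Rightarrow> nat" where
  "omega1 p = card {i. i < length p \<and> p ! i = 1}"


section \<open>Vector parking functions\<close>

text \<open>Lists are indexed from 0, so \<open>p ! i\<close> and \<open>u i\<close> stand for \<open>p\<^sub>i\<^sub>+\<^sub>1\<close> and \<open>u\<^sub>i\<^sub>+\<^sub>1\<close>.\<close>

definition PK_vec :: "nat \<Rightarrow> (nat \<Rightarrow> nat) \<Rightarrow> nat list set" where
  "PK_vec n u = {p. length p = n \<and> sorted p \<and> (\<forall>i<n. 1 \<le> p ! i \<and> p ! i \<le> u i)}"

definition u_vec :: "nat \<Rightarrow> nat \<Rightarrow> nat" where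
  "u_vec m i = m * i + 1"

definition luck_vec :: "nat \<Rightarrow> nat list \<Rightarrow> nat" where
  "luck_vec m p = card {i. i < length p \<and> p ! i = u_vec m i}"

definition gamma_sum :: "nat \<Rightarrow> nat \<Rightarrow> 'a::comm_ring_1 \<Rightarrow> 'a \<Rightarrow> 'a" where
  "gamma_sum m n q t = (\<Sum>p\<in>PK_vec n (u_vec m). q ^ luck_vec m p * t ^ omega1 p)"

definition hsym :: "nat \<Rightarrow> 'a::comm_ring_1 \<Rightarrow> 'a \<Rightarrow> 'a" where
  "hsym k q t = (\<Sum>s=0..k. q ^ (k - s) * t ^ s)"

lemma finite_PK_cat: "finite (PK_cat m n)"
  by (rule finite_subset[OF _ finite_lists_length_eq[of "{1..cat_size m n}" "cat_size m n"]])
     (auto simp: PK_cat_def)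

lemma finite_PK_vec: "finite (PK_vec n (u_vec m))"
proof (rule finite_subset)
  show "PK_vec n (u_vec m) \<subseteq> {p. set p \<subseteq> {..m * n + 1} \<and> length p = n}"
  proof (clarsimp simp: PK_vec_def u_vec_def in_set_conv_nth)
    fix p :: "nat list" and i
    assume "\<forall>j<length p. Suc 0 \<le> p ! j \<and> p ! j \<le> Suc (m * j)" "i < length p"
    then show "p ! i \<le> Suc (m * length p)"
      by (meson Suc_le_mono le_trans less_imp_le mult_le_mono2)
  qed
  show "finite {p. set p \<subseteq> {..m * n + 1} \<and> length p = n}"
    by (rule finite_lists_length_eq) simp
qed


section \<open>The indeterminates\<close>

text \<open>The ring \<open>\<int>[q,t]\<close> is represented as \<open>\<int>[q][t]\<close>.\<close>

definition var_q :: "int poly poly" where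
  "var_q = [:[:0, 1:]:]"

definition var_t :: "int poly poly" where
  "var_t = [:0, 1:]"

end

theory Submission
  imports Defs "HOL-Library.Multiset"
begin

text \<open>
  The proof has two independent parts.

  \<^bold>\<open>From trees to vectors.\<close>  All cars park exactly when every vertex ends up occupied, and this
  holds exactly when every subtree \<open>T\<close> is preferred by at least \<open>|T|\<close> cars: cars never enter a
  subtree from outside, and conversely an empty vertex stops every car of its subtree, so that
  at least one car too few preferred that subtree.  For the caterpillar these conditions say that every
  leaf is preferred and that at least \<open>b\<close> cars prefer labels up to \<open>b\<close>, for every backbone label
  \<open>b\<close> (\<open>PK_cat_iff\<close>).  As the cars arrive in the order of the labels, the occupant of a backbone
  vertex \<open>b\<close> is lucky exactly when the cars preferring smaller labels just suffice to fill the
  vertices with these labels, so that none of them reaches \<open>b\<close> (\<open>luck_cat_eq\<close>).  Dropping one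
  car for each non-backbone leaf turns the threshold for \<open>v\<^sub>i\<close> from \<open>m(i - 1) + 1\<close> into \<open>i\<close>, and
  both conditions become those of vector parking functions for \<open>(1, m + 1, 2m + 1, \<dots>)\<close>; neither
  statistic changes (\<open>bij_betw_fill_leaves\<close>).

  \<^bold>\<open>Exchanging lucky entries for ones.\<close>  In a vector parking function the first entry is \<open>1\<close> and
  lucky.  Replace the second lucky entry \<open>p\<^sub>i\<close> by a \<open>1\<close> at the front.  The entries before it move
  one place to the right, where they lie strictly below the bound because the bounds increase
  strictly; so one lucky entry is lost and one entry \<open>1\<close> is gained.  The place \<open>i\<close> can be read off
  the result, as the first one at which the entry \<open>m(i - 1) + 1\<close> can be inserted after removal of
  a \<open>1\<close>, so this is a bijection (\<open>card_PK_vec_stats_shift\<close>).  Hence the number of vector parking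
  functions with \<open>luck = a\<close> and \<open>\<omega>\<^sub>1 = b\<close> depends only on \<open>a + b\<close> for \<open>a, b \<ge> 1\<close>, and is \<open>0\<close>
  otherwise.  This gives the symmetry, and since \<open>q t h\<^sub>k(q, t)\<close> is the sum of all monomials
  \<open>q\<^sup>a t\<^sup>b\<close> with \<open>a, b \<ge> 1\<close> and \<open>a + b = k + 2\<close>, it also gives the expansion of the generating
  function (\<open>gamma_sum_eq\<close>).
\<close>


section \<open>Parking and occupied vertices in a tree\<close>

lemma parking_spot_free: "v \<notin> S \<Longrightarrow> parking_spot par S v = Some v"
  by (subst parking_spot.simps) simp

lemma parking_spot_occupied:
  "v \<in> S \<Longrightarrow> parking_spot par S v = Option.bind (par v) (parking_spot par S)"
  by (subst parking_spot.simps) simp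

lemma parking_spot_unoccupied:
  assumes "parking_spot par S v = Some w"
  shows "w \<notin> S"
  by (rule parking_spot.raw_induct[where P = "\<lambda>par S v w. w \<notin> S", rotated, OF assms])
     (auto split: if_splits simp: bind_eq_Some_conv)

text \<open>
  The spot found is an ancestor of the preferred vertex.  Ancestry is expressed through all sets
  \<open>U\<close> that are closed under parents, which avoids a separate reachability relation.
\<close>

lemma parking_spot_ancestor:
  assumes "parking_spot par S v = Some w" "v \<in> U" "\<And>x y. x \<in> U \<Longrightarrow> par x = Some y \<Longrightarrow> y \<in> U"
  shows "w \<in> U"
proof -
  let ?P = "\<lambda>par' S v w. par' = par \<longrightarrow> v \<in> U \<longrightarrow> w \<in> U"
  have "?P par S v w"
  proof (rule parking_spot.raw_induct[where P = ?P, OF _ assms(1)], intro impI)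
    fix f :: "('a \<Rightarrow> 'a option) \<Rightarrow> 'a set \<Rightarrow> 'a \<Rightarrow> 'a option" and par' S v w
    assume IH: "\<And>S v b y. f S v b = Some y \<Longrightarrow> ?P S v b y"
      and step: "(if v \<notin> S then Some v else Option.bind (par' v) (f par' S)) = Some w"
      and "par' = par" "v \<in> U"
    show "w \<in> U"
    proof (cases "v \<in> S")
      case True
      then obtain u where "par v = Some u" "f par S u = Some w"
        using step \<open>par' = par\<close> by (auto simp: bind_eq_Some_conv)
      then show ?thesis using IH[of par S u w] assms(3)[of v u] \<open>v \<in> U\<close> by simp
    next
      case False
      then show ?thesis using step \<open>v \<in> U\<close> by simp
    qed
  qed
  then show ?thesis using assms(2) by simp
qed

text \<open>
  A free vertex \<open>r\<close> catches every car driving towards it from the part \<open>D\<close> of its subtree.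
  Parents have larger numbers than their children, so the drive ends.
\<close>

lemma parking_spot_below_free_vertex:
  fixes r :: nat
  assumes "r \<notin> S" "v \<in> D" "D \<subseteq> {..r}"
    and up: "\<And>x. x \<in> D \<Longrightarrow> x \<noteq> r \<Longrightarrow> \<exists>y\<in>D. x < y \<and> par x = Some y"
  shows "\<exists>w\<in>D. parking_spot par S v = Some w"
  using \<open>v \<in> D\<close>
proof (induction "r - v" arbitrary: v rule: less_induct)
  case less
  show ?case
  proof (cases "v \<in> S")
    case True
    then obtain y where "y \<in> D" "v < y" "par v = Some y"
      using up[OF less.prems] \<open>r \<notin> S\<close> by auto
    moreover from this have "r - y < r - v" using \<open>D \<subseteq> {..r}\<close> by fastforce
    ultimately show ?thesis using less.hyps True by (simp add: parking_spot_occupied)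
  next
    case False
    then show ?thesis using less.prems by (simp add: parking_spot_free)
  qed
qed

lemma length_parking_outcome [simp]: "length (parking_outcome par S ps) = length ps"
  by (induction ps arbitrary: S) (auto simp: Let_def)

text \<open>
  This describes the recursion from the point of view of a single car: the occupied vertices
  that it meets are the initial ones and the spots of the earlier cars.
\<close>

lemma parking_outcome_nth:
  "i < length ps \<Longrightarrow> parking_outcome par S ps ! i =
     parking_spot par (S \<union> {w. \<exists>j<i. parking_outcome par S ps ! j = Some w}) (ps ! i)"
proof (induction ps arbitrary: S i)
  case (Cons p ps)
  show ?case
  proof (cases i)
    case 0
    then show ?thesis by (simp add: Let_def)
  next
    case (Suc i')
    let ?w = "parking_spot par S p"
    have "S \<union> set_option ?w \<union> {w. \<exists>j<i'. parking_outcome par (S \<union> set_option ?w) ps ! j = Some w}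
        = S \<union> {w. \<exists>j<Suc i'. (?w # parking_outcome par (S \<union> set_option ?w) ps) ! j = Some w}"
      by (auto simp: less_Suc_eq_0_disj)
    then show ?thesis using Suc Cons.prems Cons.IH[of i' "S \<union> set_option ?w"]
      by (simp add: Let_def)
  qed
qed simp

lemma parking_outcome_inj:
  assumes "i < length p" "j < length p"
    and "parking_outcome par S p ! i = Some w" "parking_outcome par S p ! j = Some w"
  shows "i = j"
proof -
  have False if "i < j" "j < length p"
    "parking_outcome par S p ! i = Some w" "parking_outcome par S p ! j = Some w" for i j
  proof -
    have "parking_spot par (S \<union> {w. \<exists>i<j. parking_outcome par S p ! i = Some w}) (p ! j) = Some w"
      using parking_outcome_nth[of j p par S] that by simp
    from parking_spot_unoccupied[OF this] show False using that by blast
  qed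
  then show ?thesis using assms by (metis linorder_neqE_nat)
qed

lemma parking_outcome_ancestor:
  assumes "i < length p" "parking_outcome par S p ! i = Some w" "p ! i \<in> U"
    and "\<And>x y. x \<in> U \<Longrightarrow> par x = Some y \<Longrightarrow> y \<in> U"
  shows "w \<in> U"
proof (rule parking_spot_ancestor[OF _ assms(3,4)])
  show "parking_spot par (S \<union> {w. \<exists>j<i. parking_outcome par S p ! j = Some w}) (p ! i) = Some w"
    using parking_outcome_nth[OF assms(1), of par S] assms(2) by simp
qed

text \<open>
  There are as many cars as vertices, so all cars park if and only if all vertices get occupied,
  and parking can be studied one vertex at a time.
\<close>

locale tree_parking =
  fixes par :: "nat \<Rightarrow> nat option" and V :: "nat set" and p :: "nat list"
  assumes finite_V: "finite V"
    and par_V: "\<And>x y. x \<in> V \<Longrightarrow> par x = Some y \<Longrightarrow> y \<in> V"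
    and length_p: "length p = card V"
    and p_V: "set p \<subseteq> V"
begin

abbreviation outcome :: "nat \<Rightarrow> nat option" where
  "outcome i \<equiv> parking_outcome par {} p ! i"

lemma preference_V: "i < card V \<Longrightarrow> p ! i \<in> V"
  using p_V length_p nth_mem[of i p] by auto

lemma outcome_V:
  assumes "i < card V" "outcome i = Some w"
  shows "w \<in> V"
  using parking_outcome_ancestor[OF _ assms(2) preference_V[OF assms(1)] par_V] assms(1) length_p
  by simp

text \<open>
  A set \<open>D\<close> that no edge enters from outside is only occupied by cars that prefer \<open>D\<close>.
\<close>

lemma preference_in_if_outcome_in:
  assumes closed: "\<And>x y. x \<in> V - D \<Longrightarrow> par x = Some y \<Longrightarrow> y \<notin> D"
    and "i < card V" "outcome i = Some w" "w \<in> D"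
  shows "p ! i \<in> D"
proof (rule ccontr)
  assume "p ! i \<notin> D"
  then have "p ! i \<in> V - D" using preference_V assms(2) by simp
  then have "w \<in> V - D"
    using parking_outcome_ancestor[of i p par "{}" w "V - D"] assms(2,3) length_p par_V closed
    by (metis Diff_iff)
  then show False using \<open>w \<in> D\<close> by simp
qed

lemma all_occupied_iff:
  "None \<notin> set (parking_outcome par {} p) \<longleftrightarrow> (\<forall>w\<in>V. \<exists>i<card V. outcome i = Some w)"
proof -
  let ?I = "{i. i < card V \<and> outcome i \<noteq> None}" and ?f = "\<lambda>i. the (outcome i)"
  have inj: "inj_on ?f ?I"
  proof (rule inj_onI)
    fix i j assume "i \<in> ?I" "j \<in> ?I" "?f i = ?f j"
    then show "i = j" using parking_outcome_inj[of i p j par "{}"] length_p by auto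
  qed
  have sub: "?f ` ?I \<subseteq> V"
    using outcome_V by auto
  have "None \<notin> set (parking_outcome par {} p) \<longleftrightarrow> (\<forall>i<card V. outcome i \<noteq> None)"
    unfolding in_set_conv_nth length_parking_outcome length_p by metis
  also have "\<dots> \<longleftrightarrow> ?I = {..<card V}"
    by blast
  also have "\<dots> \<longleftrightarrow> card ?I = card V"
  proof
    assume "card ?I = card V"
    then show "?I = {..<card V}" by (intro card_subset_eq) (simp_all add: subset_iff)
  qed (simp only: card_lessThan)
  also have "\<dots> \<longleftrightarrow> ?f ` ?I = V"
  proof
    assume "card ?I = card V"
    then show "?f ` ?I = V"
      by (intro card_subset_eq[OF finite_V sub]) (simp only: card_image[OF inj])
  qed (simp only: card_image[OF inj, symmetric])
  also have "\<dots> \<longleftrightarrow> (\<forall>w\<in>V. \<exists>i<card V. outcome i = Some w)"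
    (is "_ \<longleftrightarrow> ?all")
  proof
    assume eq: "?f ` ?I = V"
    show ?all
    proof
      fix w assume "w \<in> V"
      with eq have "w \<in> ?f ` ?I" by (rule equalityD2[THEN subsetD])
      then obtain i where "i \<in> ?I" "w = ?f i" by blast
      then show "\<exists>i<card V. outcome i = Some w" by auto
    qed
  next
    assume all: ?all
    have "V \<subseteq> ?f ` ?I"
    proof
      fix w assume "w \<in> V"
      then obtain i where "i < card V" "outcome i = Some w" using all by blast
      then have "i \<in> ?I" "w = ?f i" by simp_all
      then show "w \<in> ?f ` ?I" by blast
    qed
    then show "?f ` ?I = V" using sub by blast
  qed
  finally show ?thesis .
qed

text \<open>
  The occupants of \<open>D\<close> all prefer \<open>D\<close>, and the occupant of \<open>w\<close> does so by assumption.  For \<open>w\<close>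
  outside \<open>D\<close> this makes one car more than \<open>D\<close> can hold, which is how a car that is not lucky
  shows up in the counts.
\<close>

lemma card_insert_occupant_le_preferences:
  assumes parks: "None \<notin> set (parking_outcome par {} p)" and D: "D \<subseteq> V"
    and closed: "\<And>x y. x \<in> V - D \<Longrightarrow> par x = Some y \<Longrightarrow> y \<notin> D"
    and "w \<in> V" "i < card V" "outcome i = Some w" "p ! i \<in> D"
  shows "card (insert w D) \<le> length (filter (\<lambda>x. x \<in> D) p)"
proof -
  let ?J = "{j. j < card V \<and> p ! j \<in> D}"
  have "insert w D \<subseteq> (\<lambda>j. the (outcome j)) ` ?J"
  proof
    fix v assume v: "v \<in> insert w D"
    then obtain j where j: "j < card V" "outcome j = Some v"
      using parks all_occupied_iff D \<open>w \<in> V\<close> by blast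
    have "p ! j \<in> D"
    proof (cases "v = w")
      case True
      then have "j = i" using parking_outcome_inj[of j p i par "{}" w] j assms length_p by simp
      then show ?thesis using \<open>p ! i \<in> D\<close> by simp
    next
      case False
      then show ?thesis using preference_in_if_outcome_in[OF closed j] v by simp
    qed
    then have "j \<in> ?J" "v = the (outcome j)" using j by simp_all
    then show "v \<in> (\<lambda>j. the (outcome j)) ` ?J" by blast
  qed
  then have "card (insert w D) \<le> card ?J"
    by (rule surj_card_le[rotated]) simp
  then show ?thesis by (simp add: length_filter_conv_card length_p)
qed

lemma card_subtree_le_preferences:
  assumes parks: "None \<notin> set (parking_outcome par {} p)" and D: "D \<subseteq> V"
    and closed: "\<And>x y. x \<in> V - D \<Longrightarrow> par x = Some y \<Longrightarrow> y \<notin> D"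
  shows "card D \<le> length (filter (\<lambda>x. x \<in> D) p)"
proof (cases "D = {}")
  case False
  then obtain w where w: "w \<in> D" by blast
  then obtain i where i: "i < card V" "outcome i = Some w"
    using parks all_occupied_iff D by blast
  have "p ! i \<in> D" using preference_in_if_outcome_in[OF closed i w] .
  then show ?thesis
    using card_insert_occupant_le_preferences[OF parks D closed _ i] w D by (auto simp: insert_absorb)
qed simp

text \<open>
  As long as \<open>r\<close> is free, the cars preferring \<open>D\<close> park in \<open>D\<close> below \<open>r\<close>.  The set \<open>J\<close> of cars
  may be smaller than the set of all cars preferring \<open>D\<close>: if a lucky car parks at \<open>r\<close>, then
  \<open>r\<close> is known to be free only for the cars preferring \<open>D - {r}\<close>, which arrive before it.
\<close>

lemma preferences_below_free_vertex:
  assumes "D \<subseteq> V" "D \<subseteq> {..r}"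
    and up: "\<And>x. x \<in> D \<Longrightarrow> x \<noteq> r \<Longrightarrow> \<exists>y\<in>D. x < y \<and> par x = Some y"
    and J: "J \<subseteq> {j. j < card V \<and> p ! j \<in> D}"
    and free: "\<And>i j. j \<in> J \<Longrightarrow> i \<le> j \<Longrightarrow> outcome i \<noteq> Some r"
  shows "card J \<le> card (D - {r})"
proof (rule card_inj_on_le)
  let ?f = "\<lambda>j. the (outcome j)"
  have some: "\<exists>w\<in>D - {r}. outcome j = Some w" if "j \<in> J" for j
  proof -
    have "j < length p" "p ! j \<in> D" using that J length_p by auto
    have "r \<notin> {} \<union> {w. \<exists>i<j. outcome i = Some w}"
      using free[OF that] by (auto dest: less_imp_le)
    from parking_spot_below_free_vertex[OF this \<open>p ! j \<in> D\<close> \<open>D \<subseteq> {..r}\<close> up]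
    obtain w where "w \<in> D"
      "parking_spot par ({} \<union> {w. \<exists>i<j. outcome i = Some w}) (p ! j) = Some w"
      by blast
    note w = \<open>w \<in> D\<close> trans[OF parking_outcome_nth[OF \<open>j < length p\<close>] this(2)]
    have "w \<noteq> r" using w(2) free[OF that order_refl] by metis
    then show ?thesis using w by blast
  qed
  show "inj_on ?f J"
  proof (rule inj_onI)
    fix i j assume ij: "i \<in> J" "j \<in> J" "?f i = ?f j"
    then have "i < length p" "j < length p" using J length_p by auto
    then show "i = j"
      using some[OF ij(1)] some[OF ij(2)] ij(3) parking_outcome_inj[of i p j par "{}"] by auto
  qed
  show "?f ` J \<subseteq> D - {r}"
  proof (rule image_subsetI)
    fix j assume "j \<in> J"
    then show "?f j \<in> D - {r}" using some[of j] by auto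
  qed
  show "finite (D - {r})" using finite_V \<open>D \<subseteq> V\<close> by (meson finite_Diff finite_subset)
qed

text \<open>
  The converse of \<open>card_subtree_le_preferences\<close>: if some car failed, some vertex \<open>r\<close> would stay
  empty, and the cars preferring its subtree \<open>D\<close> would fit into \<open>D - {r}\<close>.
\<close>

lemma parks_if_preferences:
  assumes "\<And>r. r \<in> V \<Longrightarrow> \<exists>D\<subseteq>V. r \<in> D \<and> D \<subseteq> {..r} \<and>
      (\<forall>x\<in>D. x \<noteq> r \<longrightarrow> (\<exists>y\<in>D. x < y \<and> par x = Some y)) \<and>
      card D \<le> length (filter (\<lambda>x. x \<in> D) p)"
  shows "None \<notin> set (parking_outcome par {} p)"
proof (rule ccontr)
  assume "\<not> None \<notin> set (parking_outcome par {} p)"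
  then obtain r where r: "r \<in> V" and free: "\<And>i. i < card V \<Longrightarrow> outcome i \<noteq> Some r"
    using all_occupied_iff by blast
  obtain D where D: "D \<subseteq> V" "r \<in> D" "D \<subseteq> {..r}"
      "\<forall>x\<in>D. x \<noteq> r \<longrightarrow> (\<exists>y\<in>D. x < y \<and> par x = Some y)"
      "card D \<le> length (filter (\<lambda>x. x \<in> D) p)"
    using assms[OF r] by metis
  have "card {j. j < card V \<and> p ! j \<in> D} \<le> card (D - {r})"
    using D r free by (intro preferences_below_free_vertex) (auto dest: le_less_trans)
  moreover have "card (D - {r}) < card D"
    using D finite_V by (meson card_Diff1_less finite_subset)
  ultimately show False using D(5) by (simp add: length_filter_conv_card length_p)
qed

text \<open>
  Here \<open>D\<close> is the subtree of \<open>r\<close> without \<open>r\<close>.  Since the preferences are sorted, all cars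
  preferring \<open>D\<close> arrive before those preferring \<open>r\<close>; so a car can find its preferred vertex \<open>r\<close>
  free only if the cars preferring \<open>D\<close> fit into \<open>D\<close>.  If they do fit, they fill \<open>D\<close> exactly and
  the occupant of \<open>r\<close> has to be a car that prefers \<open>r\<close>.
\<close>

lemma occupant_prefers_own_vertex_iff:
  assumes parks: "None \<notin> set (parking_outcome par {} p)" and srt: "sorted p"
    and r: "r \<in> V" and D: "D \<subseteq> V" "D \<subseteq> {..<r}"
    and up: "\<And>x. x \<in> D \<Longrightarrow> \<exists>y\<in>insert r D. x < y \<and> par x = Some y"
    and closed: "\<And>x y. x \<in> V - D \<Longrightarrow> par x = Some y \<Longrightarrow> y \<notin> D"
    and closed_r: "\<And>x. x \<in> V \<Longrightarrow> par x = Some r \<Longrightarrow> x \<in> D"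
  shows "(\<exists>i<card V. p ! i = r \<and> outcome i = Some r) \<longleftrightarrow>
           length (filter (\<lambda>x. x \<in> D) p) \<le> card D"
proof
  assume "\<exists>i<card V. p ! i = r \<and> outcome i = Some r"
  then obtain i where i: "i < card V" "p ! i = r" "outcome i = Some r" by blast
  have early: "j < i" if "j < card V" "p ! j \<in> D" for j
  proof (rule ccontr)
    assume "\<not> j < i"
    then have "r \<le> p ! j" using sorted_nth_mono[OF srt, of i j] that i length_p by simp
    moreover have "p ! j < r" using that D by auto
    ultimately show False by simp
  qed
  have "card {j. j < card V \<and> p ! j \<in> D} \<le> card (insert r D - {r})"
  proof (rule preferences_below_free_vertex)
    fix k j assume "j \<in> {j. j < card V \<and> p ! j \<in> D}" "k \<le> j"
    then have "k < i" using early[of j] by simp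
    then show "outcome k \<noteq> Some r"
      using i parking_outcome_inj[of k p i par "{}" r] length_p by auto
  qed (use r D up in auto)
  moreover have "insert r D - {r} = D" using D by auto
  ultimately show "length (filter (\<lambda>x. x \<in> D) p) \<le> card D"
    by (simp add: length_filter_conv_card length_p)
next
  assume few: "length (filter (\<lambda>x. x \<in> D) p) \<le> card D"
  obtain i where i: "i < card V" "outcome i = Some r"
    using parks all_occupied_iff r by blast
  have "p ! i \<notin> D"
  proof
    assume "p ! i \<in> D"
    then have "card (insert r D) \<le> length (filter (\<lambda>x. x \<in> D) p)"
      using closed by (intro card_insert_occupant_le_preferences[OF parks D(1) _ r i]) blast+
    then have "card (insert r D) \<le> card D" using few by simp
    moreover have "finite D" "r \<notin> D" using D finite_V finite_subset by auto
    ultimately show False by simp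
  qed
  moreover have "p ! i \<in> insert r D"
    using closed closed_r i by (intro preference_in_if_outcome_in[of "insert r D" i r]) auto
  ultimately show "\<exists>i<card V. p ! i = r \<and> outcome i = Some r" using i by auto
qed

end


section \<open>Parking distributions on the caterpillar by counting\<close>

lemma cat_size_eq: "n \<ge> 1 \<Longrightarrow> cat_size m n = m * (n - 1) + 1"
  using backbone_sink[of n m] by (simp add: backbone_def)

lemma backbone_Suc: "backbone m (Suc i) = u_vec m i"
  by (simp add: backbone_def u_vec_def)

lemma backbone_mono: "i \<le> j \<Longrightarrow> backbone m i \<le> backbone m j"
  unfolding backbone_def by (intro add_right_mono mult_le_mono2 diff_le_mono)

lemma backbone_strict_mono: "m \<ge> 1 \<Longrightarrow> 1 \<le> i \<Longrightarrow> i < j \<Longrightarrow> backbone m i < backbone m j"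
  by (simp add: backbone_def)

lemma backbone_le_iff:
  "m \<ge> 1 \<Longrightarrow> 1 \<le> i \<Longrightarrow> 1 \<le> j \<Longrightarrow> backbone m i \<le> backbone m j \<longleftrightarrow> i \<le> j"
  using backbone_mono[of i j m] backbone_strict_mono[of m j i] by linarith

lemma inj_on_backbone: "m \<ge> 1 \<Longrightarrow> inj_on (backbone m) {1..}"
  by (rule inj_onI) (metis atLeast_iff backbone_le_iff le_antisym order_refl)

lemma backbone_range: "n \<ge> 1 \<Longrightarrow> i \<in> {1..n} \<Longrightarrow> backbone m i \<in> {1..cat_size m n}"
  using backbone_mono[of i n m] by (simp add: backbone_sink) (simp add: cat_size_def)

lemma index_le_backbone: "m \<ge> 1 \<Longrightarrow> 1 \<le> i \<Longrightarrow> i \<le> backbone m i"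
  by (cases i) (simp_all add: backbone_def)

lemma cat_parent_SomeD:
  assumes "m \<ge> 1" "n \<ge> 1" "1 \<le> k" "cat_parent m n k = Some y"
  shows "k < y" "y \<in> backbone m ` {1..n}"
proof -
  let ?d = "(k - 1) div m"
  have k: "k < cat_size m n" and y: "y = m * (?d + 1) + 1"
    using assms(4) by (auto simp: cat_parent_def split: if_splits)
  have "k - 1 < m * Suc ?d" using dividend_less_times_div[of m "k - 1"] assms(1) by simp
  then show "k < y" using y by simp
  have "k - 1 < (n - 1) * m" using k assms(2,3) by (simp add: cat_size_eq mult.commute)
  then have "?d < n - 1" by (rule less_mult_imp_div_less)
  then show "y \<in> backbone m ` {1..n}"
    using y by (intro image_eqI[of _ _ "?d + 2"]) (auto simp: backbone_def)
qed

text \<open>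
  The subtree of the backbone vertex with label \<open>b\<close> consists of the labels \<open>1, \<dots>, b\<close>.
\<close>

lemma cat_parent_below_backbone:
  assumes "m \<ge> 1" "n \<ge> 1" "i \<in> {1..n}" "k \<in> {1..<backbone m i}"
  shows "\<exists>y\<in>{1..backbone m i}. k < y \<and> cat_parent m n k = Some y"
proof -
  let ?d = "(k - 1) div m"
  have "k < cat_size m n" using backbone_range[of n i m] assms by simp
  then have par: "cat_parent m n k = Some (m * (?d + 1) + 1)" by (simp add: cat_parent_def)
  have "k - 1 < (i - 1) * m" using assms(4) by (auto simp: backbone_def mult.commute)
  then have "?d < i - 1" by (rule less_mult_imp_div_less)
  then have "m * (?d + 1) \<le> m * (i - 1)" by (intro mult_le_mono2) simp
  then show ?thesis
    using par cat_parent_SomeD(1)[OF assms(1,2) _ par] assms(4) by (auto simp: backbone_def)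
qed

text \<open>
  The leaf \<open>v\<^sub>1\<close> does not belong to this set: it counts as a backbone vertex.
\<close>

definition cat_leaves :: "nat \<Rightarrow> nat \<Rightarrow> nat set" where
  "cat_leaves m n = {1..cat_size m n} - backbone m ` {1..n}"

lemma finite_cat_leaves [simp]: "finite (cat_leaves m n)"
  by (simp add: cat_leaves_def)

text \<open>
  Among the labels \<open>1, \<dots>, backbone m i\<close>, exactly \<open>i\<close> belong to the backbone.
\<close>

lemma card_cat_leaves_le:
  assumes m: "m \<ge> 1" and n: "n \<ge> 1" and i: "i \<in> {1..n}"
  shows "card {x \<in> cat_leaves m n. x \<le> backbone m i} = backbone m i - i"
proof -
  have "{x \<in> cat_leaves m n. x \<le> backbone m i} = {1..backbone m i} - backbone m ` {1..i}"
    using backbone_range[OF n i, of m] i backbone_le_iff[OF m]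
    by (auto simp: cat_leaves_def)
  moreover have "backbone m ` {1..i} \<subseteq> {1..backbone m i}"
    using backbone_mono[of _ i m] by (auto simp: backbone_def)
  moreover have "card (backbone m ` {1..i}) = i"
    using inj_on_subset[OF inj_on_backbone[OF m], of "{1..i}"] by (subst card_image) auto
  ultimately show ?thesis by (simp add: card_Diff_subset)
qed

lemma card_cat_leaves_less:
  assumes "m \<ge> 1" "n \<ge> 1" "i \<in> {1..n}"
  shows "card {x \<in> cat_leaves m n. x < backbone m i} = backbone m i - i"
proof -
  have "{x \<in> cat_leaves m n. x < backbone m i} = {x \<in> cat_leaves m n. x \<le> backbone m i}"
    using assms(3) by (auto simp: cat_leaves_def le_less)
  then show ?thesis using card_cat_leaves_le[OF assms] by simp
qed

lemma card_cat_leaves: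
  assumes "m \<ge> 1" "n \<ge> 1"
  shows "card (cat_leaves m n) = cat_size m n - n"
proof -
  have "{x \<in> cat_leaves m n. x \<le> backbone m n} = cat_leaves m n"
    using backbone_sink[OF assms(2), of m] by (auto simp: cat_leaves_def)
  then show ?thesis using card_cat_leaves_le[OF assms, of n] backbone_sink[OF assms(2), of m] assms by simp
qed

lemma tree_parking_cat:
  assumes "m \<ge> 1" "n \<ge> 1" "length p = cat_size m n" "set p \<subseteq> {1..cat_size m n}"
  shows "tree_parking (cat_parent m n) {1..cat_size m n} p"
proof
  fix x y assume x: "x \<in> {1..cat_size m n}" "cat_parent m n x = Some y"
  then show "y \<in> {1..cat_size m n}"
    using cat_parent_SomeD(2)[OF assms(1,2) _ x(2)] backbone_range[OF assms(2)] by fastforce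
qed (use assms in auto)

lemma filter_interval_eq:
  assumes "set p \<subseteq> {1..N::nat}"
  shows "filter (\<lambda>x. x \<in> {1..b}) p = filter (\<lambda>x. x \<le> b) p"
    and "filter (\<lambda>x. x \<in> {1..<b}) p = filter (\<lambda>x. x < b) p"
  using assms by (auto intro!: filter_cong)

text \<open>
  The subtrees are the single leaves and the intervals \<open>{1..b}\<close> for backbone labels \<open>b\<close>.
\<close>

lemma PK_cat_iff:
  assumes m: "m \<ge> 1" and n: "n \<ge> 1"
  shows "p \<in> PK_cat m n \<longleftrightarrow>
    length p = cat_size m n \<and> sorted p \<and> set p \<subseteq> {1..cat_size m n} \<and> cat_leaves m n \<subseteq> set p \<and>
    (\<forall>i\<in>{1..n}. backbone m i \<le> length (filter (\<lambda>x. x \<le> backbone m i) p))"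
    (is "_ \<longleftrightarrow> _ \<and> _ \<and> _ \<and> ?leaves \<and> ?backbone")
proof (cases "length p = cat_size m n \<and> set p \<subseteq> {1..cat_size m n}")
  case True
  then have len: "length p = cat_size m n" and sub: "set p \<subseteq> {1..cat_size m n}" by auto
  interpret tree_parking "cat_parent m n" "{1..cat_size m n}" p
    using tree_parking_cat[OF m n len sub] .
  have "None \<notin> set (parking_outcome (cat_parent m n) {} p) \<longleftrightarrow> ?leaves \<and> ?backbone"
  proof
    assume parks: "None \<notin> set (parking_outcome (cat_parent m n) {} p)"
    have ?leaves
    proof
      fix x assume x: "x \<in> cat_leaves m n"
      have "card {x} \<le> length (filter (\<lambda>y. y \<in> {x}) p)"
      proof (rule card_subtree_le_preferences[OF parks])
        fix k y assume "k \<in> {1..cat_size m n} - {x}" "cat_parent m n k = Some y"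
        then show "y \<notin> {x}" using x cat_parent_SomeD(2)[OF m n, of k y] by (auto simp: cat_leaves_def)
      qed (use x in \<open>auto simp: cat_leaves_def\<close>)
      then have "filter (\<lambda>y. y \<in> {x}) p \<noteq> []" by auto
      then show "x \<in> set p" by (auto simp: filter_empty_conv)
    qed
    moreover have ?backbone
    proof
      fix i assume i: "i \<in> {1..n}"
      have "card {1..backbone m i} \<le> length (filter (\<lambda>x. x \<in> {1..backbone m i}) p)"
      proof (rule card_subtree_le_preferences[OF parks])
        fix k y assume "k \<in> {1..cat_size m n} - {1..backbone m i}" "cat_parent m n k = Some y"
        then show "y \<notin> {1..backbone m i}" using cat_parent_SomeD(1)[OF m n, of k y] by auto
      qed (use backbone_range[OF n i, of m] in auto)
      then show "backbone m i \<le> length (filter (\<lambda>x. x \<le> backbone m i) p)"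
        unfolding filter_interval_eq[OF sub] by simp
    qed
    ultimately show "?leaves \<and> ?backbone" ..
  next
    assume cond: "?leaves \<and> ?backbone"
    show "None \<notin> set (parking_outcome (cat_parent m n) {} p)"
    proof (rule parks_if_preferences)
      fix r assume r: "r \<in> {1..cat_size m n}"
      show "\<exists>D\<subseteq>{1..cat_size m n}. r \<in> D \<and> D \<subseteq> {..r} \<and>
        (\<forall>x\<in>D. x \<noteq> r \<longrightarrow> (\<exists>y\<in>D. x < y \<and> cat_parent m n x = Some y)) \<and>
        card D \<le> length (filter (\<lambda>x. x \<in> D) p)"
      proof (cases "r \<in> cat_leaves m n")
        case True
        then have "r \<in> set p" using cond by blast
        then have "filter (\<lambda>x. x \<in> {r}) p \<noteq> []" by (auto simp: filter_empty_conv)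
        then have "card {r} \<le> length (filter (\<lambda>x. x \<in> {r}) p)" by (simp add: Suc_le_eq)
        then show ?thesis using r by (intro exI[of _ "{r}"]) auto
      next
        case False
        then obtain i where i: "i \<in> {1..n}" "r = backbone m i"
          using r by (auto simp: cat_leaves_def)
        have "card {1..r} \<le> length (filter (\<lambda>x. x \<in> {1..r}) p)"
          unfolding filter_interval_eq[OF sub] using cond i by simp
        moreover have "\<exists>y\<in>{1..r}. x < y \<and> cat_parent m n x = Some y" if "x \<in> {1..r}" "x \<noteq> r" for x
          using cat_parent_below_backbone[OF m n i(1), of x] that i(2) by auto
        ultimately show ?thesis using r by (intro exI[of _ "{1..r}"]) auto
      qed
    qed
  qed
  then show ?thesis using True by (simp add: PK_cat_def)
qed (auto simp: PK_cat_def)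

text \<open>
  A vertex has only one occupant, so lucky cars correspond to the backbone vertices whose
  occupant prefers them, and these are recognised by a count of smaller preferences.
\<close>

lemma luck_cat_eq:
  assumes m: "m \<ge> 1" and n: "n \<ge> 1" and p: "p \<in> PK_cat m n"
  shows "luck_cat m n p =
    card {i \<in> {1..n}. length (filter (\<lambda>x. x < backbone m i) p) < backbone m i}"
proof -
  let ?N = "cat_size m n" and ?o = "\<lambda>i. parking_outcome (cat_parent m n) {} p ! i"
  let ?C = "{i. i < length p \<and> p ! i \<in> backbone m ` {1..n} \<and> ?o i = Some (p ! i)}"
  let ?R = "{i \<in> {1..n}. length (filter (\<lambda>x. x < backbone m i) p) < backbone m i}"
  have len: "length p = ?N" and sub: "set p \<subseteq> {1..?N}" and srt: "sorted p"
    and parks: "None \<notin> set (parking_outcome (cat_parent m n) {} p)"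
    using p by (auto simp: PK_cat_def)
  interpret tree_parking "cat_parent m n" "{1..?N}" p
    using tree_parking_cat[OF m n len sub] .
  have lucky_iff: "(\<exists>j<length p. p ! j = backbone m i \<and> ?o j = Some (backbone m i)) \<longleftrightarrow> i \<in> ?R"
    if i: "i \<in> {1..n}" for i
  proof -
    let ?b = "backbone m i"
    have b: "?b \<in> {1..?N}" using backbone_range[OF n i] .
    have "(\<exists>j<card {1..?N}. p ! j = ?b \<and> ?o j = Some ?b) \<longleftrightarrow>
        length (filter (\<lambda>x. x \<in> {1..<?b}) p) \<le> card {1..<?b}"
    proof (rule occupant_prefers_own_vertex_iff[OF parks srt b])
      show "\<exists>y\<in>insert ?b {1..<?b}. x < y \<and> cat_parent m n x = Some y" if "x \<in> {1..<?b}" for x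
        using cat_parent_below_backbone[OF m n i that] that by force
      show "y \<notin> {1..<?b}" if "x \<in> {1..?N} - {1..<?b}" "cat_parent m n x = Some y" for x y
        using cat_parent_SomeD(1)[OF m n _ that(2)] that(1) by auto
      show "x \<in> {1..<?b}" if "x \<in> {1..?N}" "cat_parent m n x = Some ?b" for x
        using cat_parent_SomeD(1)[OF m n _ that(2)] that(1) by auto
    qed (use b in auto)
    also have "\<dots> \<longleftrightarrow> i \<in> ?R"
      unfolding filter_interval_eq[OF sub] using i b by auto
    finally show ?thesis using len by simp
  qed
  have inj: "inj_on (\<lambda>j. p ! j) ?C"
  proof (rule inj_onI)
    fix i j assume ij: "i \<in> ?C" "j \<in> ?C" "p ! i = p ! j"
    then show "i = j"
      by (intro parking_outcome_inj[of i p j "cat_parent m n" "{}" "p ! i"]) auto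
  qed
  have "(\<lambda>j. p ! j) ` ?C = backbone m ` ?R"
  proof
    show "(\<lambda>j. p ! j) ` ?C \<subseteq> backbone m ` ?R"
    proof
      fix v assume "v \<in> (\<lambda>j. p ! j) ` ?C"
      then obtain i j where "i \<in> {1..n}" "v = backbone m i" "j < length p" "p ! j = v" "?o j = Some v"
        by auto
      then show "v \<in> backbone m ` ?R" using lucky_iff[of i] by blast
    qed
    show "backbone m ` ?R \<subseteq> (\<lambda>j. p ! j) ` ?C"
    proof
      fix v assume "v \<in> backbone m ` ?R"
      then obtain i where i: "i \<in> ?R" "v = backbone m i" by blast
      then have "i \<in> {1..n}" by simp
      then obtain j where "j < length p" "p ! j = v" "?o j = Some v"
        using lucky_iff[of i] i by blast
      then have "j \<in> ?C" "v = p ! j" using i \<open>i \<in> {1..n}\<close> by auto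
      then show "v \<in> (\<lambda>j. p ! j) ` ?C" by blast
    qed
  qed
  then have "card ?C = card (backbone m ` ?R)"
    using card_image[OF inj] by simp
  also have "\<dots> = card ?R"
    by (rule card_image) (rule inj_on_subset[OF inj_on_backbone[OF m]], auto)
  finally show ?thesis by (simp only: luck_cat_def)
qed


section \<open>From caterpillars to vectors by filling the leaves\<close>

text \<open>
  In a sorted list the entries satisfying a downward closed condition form an initial segment.
  This translates bounds on single entries into counts, the form in which the conditions on the
  caterpillar are available.
\<close>

lemma sorted_nth_iff_less_length_filter:
  assumes srt: "sorted q" and i: "i < length q"
    and down: "\<And>a b. a \<le> b \<Longrightarrow> P b \<Longrightarrow> P a"
  shows "P (q ! i) \<longleftrightarrow> i < length (filter P q)"
proof
  assume "P (q ! i)"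
  then have "P (q ! j)" if "j \<le> i" for j
    using down sorted_nth_mono[OF srt that i] by blast
  then have "{..i} \<subseteq> {j. j < length q \<and> P (q ! j)}"
    using i by auto
  then have "card {..i} \<le> length (filter P q)"
    unfolding length_filter_conv_card by (intro card_mono) auto
  then show "i < length (filter P q)" by simp
next
  assume less: "i < length (filter P q)"
  show "P (q ! i)"
  proof (rule ccontr)
    assume "\<not> P (q ! i)"
    then have "\<not> P (q ! j)" if "i \<le> j" "j < length q" for j
      using down sorted_nth_mono[OF srt that] by blast
    then have "{j. j < length q \<and> P (q ! j)} \<subseteq> {..<i}"
      by (auto simp flip: not_le)
    then have "length (filter P q) \<le> card {..<i}"
      unfolding length_filter_conv_card by (intro card_mono) auto
    then show False using less by simp
  qed
qed

lemma omega1_eq_length_filter: "omega1 p = length (filter (\<lambda>x. x = 1) p)"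
  by (simp add: omega1_def length_filter_conv_card)

text \<open>
  This has the form of \<open>PK_cat_iff\<close> with the threshold \<open>backbone m i\<close> replaced by \<open>i\<close>.
\<close>

lemma PK_vec_iff:
  assumes "length q = n" "sorted q"
  shows "q \<in> PK_vec n (u_vec m) \<longleftrightarrow> (\<forall>x\<in>set q. 1 \<le> x) \<and>
           (\<forall>i\<in>{1..n}. i \<le> length (filter (\<lambda>x. x \<le> backbone m i) q))"
proof -
  have "(\<forall>i<n. q ! i \<le> u_vec m i) \<longleftrightarrow>
      (\<forall>i<n. Suc i \<le> length (filter (\<lambda>x. x \<le> backbone m (Suc i)) q))"
    using sorted_nth_iff_less_length_filter[OF assms(2), of _ "\<lambda>x. x \<le> u_vec m _"] assms(1)
    by (auto simp: Suc_le_eq backbone_Suc)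
  also have "\<dots> \<longleftrightarrow> (\<forall>i\<in>Suc ` {..<n}. i \<le> length (filter (\<lambda>x. x \<le> backbone m i) q))"
    by auto
  also have "Suc ` {..<n} = {1..n}" by (simp add: image_Suc_lessThan)
  finally show ?thesis
    using assms by (auto simp: PK_vec_def all_set_conv_all_nth)
qed

lemma luck_vec_eq:
  assumes q: "q \<in> PK_vec n (u_vec m)"
  shows "luck_vec m q = card {i \<in> {1..n}. length (filter (\<lambda>x. x < backbone m i) q) < i}"
proof -
  have len: "length q = n" and srt: "sorted q" and le: "\<And>i. i < n \<Longrightarrow> q ! i \<le> u_vec m i"
    using q by (auto simp: PK_vec_def)
  have "q ! i = u_vec m i \<longleftrightarrow> length (filter (\<lambda>x. x < backbone m (Suc i)) q) < Suc i" if "i < n" for i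
  proof -
    have "q ! i = u_vec m i \<longleftrightarrow> \<not> q ! i < u_vec m i" using le[OF that] by auto
    also have "\<dots> \<longleftrightarrow> \<not> i < length (filter (\<lambda>x. x < u_vec m i) q)"
      using sorted_nth_iff_less_length_filter[OF srt, of i "\<lambda>x. x < u_vec m i"] that len by auto
    finally show ?thesis by (simp add: backbone_Suc not_less less_Suc_eq_le)
  qed
  then have "{i \<in> {1..n}. length (filter (\<lambda>x. x < backbone m i) q) < i} =
      Suc ` {i. i < length q \<and> q ! i = u_vec m i}"
    unfolding len by (auto simp: image_iff Suc_le_eq gr0_conv_Suc)
  then show ?thesis by (simp add: luck_vec_def card_image)
qed

definition fill_leaves :: "nat \<Rightarrow> nat \<Rightarrow> nat list \<Rightarrow> nat list" where
  "fill_leaves m n q = sorted_list_of_multiset (mset q + mset_set (cat_leaves m n))"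

lemma length_filter_fill_leaves:
  "length (filter P (fill_leaves m n q)) =
     length (filter P q) + card {x \<in> cat_leaves m n. P x}"
proof -
  have "length (filter P (fill_leaves m n q)) = size (filter_mset P (mset (fill_leaves m n q)))"
    by (simp flip: mset_filter)
  also have "\<dots> = length (filter P q) + card {x \<in> cat_leaves m n. P x}"
    by (simp add: fill_leaves_def filter_mset_mset_set flip: mset_filter)
  finally show ?thesis .
qed

lemma set_fill_leaves: "set (fill_leaves m n q) = set q \<union> cat_leaves m n"
  by (simp add: fill_leaves_def)

lemma sorted_fill_leaves: "sorted (fill_leaves m n q)"
  by (simp add: fill_leaves_def)

lemma length_fill_leaves: "length (fill_leaves m n q) = length q + card (cat_leaves m n)"
  using length_filter_fill_leaves[of "\<lambda>_. True"] by simp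

text \<open>
  There are \<open>backbone m i - i\<close> leaves outside the backbone up to \<open>v\<^sub>i\<close>, which is the difference
  of the two thresholds.
\<close>

lemma fill_leaves_mem_PK_cat_iff:
  assumes m: "m \<ge> 1" and n: "n \<ge> 1" and q: "length q = n" "sorted q"
  shows "fill_leaves m n q \<in> PK_cat m n \<longleftrightarrow> q \<in> PK_vec n (u_vec m)"
proof -
  let ?enough = "\<forall>i\<in>{1..n}. i \<le> length (filter (\<lambda>x. x \<le> backbone m i) q)"
  have "length (fill_leaves m n q) = cat_size m n"
    using card_cat_leaves[OF m n] q(1) index_le_backbone[OF m n] backbone_sink[OF n, of m]
    by (simp add: length_fill_leaves)
  moreover have "backbone m i \<le> length (filter (\<lambda>x. x \<le> backbone m i) (fill_leaves m n q)) \<longleftrightarrow>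
      i \<le> length (filter (\<lambda>x. x \<le> backbone m i) q)" if "i \<in> {1..n}" for i
    using card_cat_leaves_le[OF m n that] index_le_backbone[OF m, of i] that
    by (simp add: length_filter_fill_leaves) linarith
  \<comment> \<open>The condition for the sink bounds all entries by the number of vertices.\<close>
  moreover have "set q \<subseteq> {1..cat_size m n}" if "\<forall>x\<in>set q. 1 \<le> x" ?enough
  proof -
    have "n \<le> length (filter (\<lambda>x. x \<le> cat_size m n) q)"
      using that(2) n backbone_sink[OF n, of m] by (metis atLeastAtMost_iff order_refl)
    then have "length (filter (\<lambda>x. x \<le> cat_size m n) q) = length q"
      using q(1) length_filter_le[of "\<lambda>x. x \<le> cat_size m n" q] by linarith
    then have "\<forall>x\<in>set q. x \<le> cat_size m n"
      by (metis length_filter_less less_irrefl)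
    then show ?thesis using that(1) by auto
  qed
  ultimately show ?thesis
    unfolding PK_cat_iff[OF m n] PK_vec_iff[OF q]
    by (auto simp: set_fill_leaves sorted_fill_leaves) (auto simp: cat_leaves_def)
qed

lemma luck_cat_fill_leaves:
  assumes m: "m \<ge> 1" and n: "n \<ge> 1" and q: "q \<in> PK_vec n (u_vec m)"
  shows "luck_cat m n (fill_leaves m n q) = luck_vec m q"
proof -
  have "length q = n" "sorted q" using q by (auto simp: PK_vec_def)
  then have "fill_leaves m n q \<in> PK_cat m n"
    using fill_leaves_mem_PK_cat_iff[OF m n] q by blast
  note luck_cat_eq[OF m n this]
  moreover have "length (filter (\<lambda>x. x < backbone m i) (fill_leaves m n q)) < backbone m i \<longleftrightarrow>
      length (filter (\<lambda>x. x < backbone m i) q) < i" if "i \<in> {1..n}" for i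
    using card_cat_leaves_less[OF m n that] index_le_backbone[OF m, of i] that
    by (simp add: length_filter_fill_leaves) linarith
  ultimately show ?thesis
    unfolding luck_vec_eq[OF q] by (metis (no_types, lifting) Collect_cong)
qed

lemma omega1_fill_leaves:
  assumes n: "n \<ge> 1"
  shows "omega1 (fill_leaves m n q) = omega1 q"
proof -
  have "1 \<in> backbone m ` {1..n}"
    using n by (intro image_eqI[of _ _ 1]) (auto simp: backbone_def)
  then have "{x \<in> cat_leaves m n. x = 1} = {}" by (auto simp: cat_leaves_def)
  then show ?thesis unfolding omega1_eq_length_filter length_filter_fill_leaves by simp
qed

text \<open>
  The inverse map takes away one car from every leaf outside the backbone; this is possible
  because each of these leaves is preferred by some car.
\<close>

lemma bij_betw_fill_leaves:
  assumes m: "m \<ge> 1" and n: "n \<ge> 1"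
  shows "bij_betw (fill_leaves m n) (PK_vec n (u_vec m)) (PK_cat m n)"
  unfolding bij_betw_def
proof
  show "inj_on (fill_leaves m n) (PK_vec n (u_vec m))"
  proof (rule inj_onI)
    fix p q assume "p \<in> PK_vec n (u_vec m)" "q \<in> PK_vec n (u_vec m)"
      and eq: "fill_leaves m n p = fill_leaves m n q"
    then have "sorted p" "sorted q" by (auto simp: PK_vec_def)
    moreover have "mset p = mset q"
      using arg_cong[OF eq, of mset] by (simp add: fill_leaves_def)
    ultimately show "p = q" by (metis properties_for_sort)
  qed
  show "fill_leaves m n ` PK_vec n (u_vec m) = PK_cat m n"
  proof
    show "fill_leaves m n ` PK_vec n (u_vec m) \<subseteq> PK_cat m n"
      using fill_leaves_mem_PK_cat_iff[OF m n] by (auto simp: PK_vec_def)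
    show "PK_cat m n \<subseteq> fill_leaves m n ` PK_vec n (u_vec m)"
    proof
      fix p assume p: "p \<in> PK_cat m n"
      define q where "q = sorted_list_of_multiset (mset p - mset_set (cat_leaves m n))"
      have leaves: "cat_leaves m n \<subseteq> set p" and srt: "sorted p" and len: "length p = cat_size m n"
        using p unfolding PK_cat_iff[OF m n] by auto
      have "mset_set (cat_leaves m n) \<subseteq># mset p"
        using leaves by (auto simp: subseteq_mset_def count_mset_set' Suc_le_eq)
      then have "mset q + mset_set (cat_leaves m n) = mset p"
        by (simp add: q_def)
      then have fill: "fill_leaves m n q = p"
        using srt by (simp add: fill_leaves_def sorted_list_of_multiset_mset sorted_sort_id)
      have "length q = n"
        using length_fill_leaves[of m n q] len card_cat_leaves[OF m n] index_le_backbone[OF m n]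
          backbone_sink[OF n, of m] by (simp add: fill)
      moreover have "sorted q" by (simp add: q_def)
      ultimately have "q \<in> PK_vec n (u_vec m)"
        using fill_leaves_mem_PK_cat_iff[OF m n] fill p by blast
      then show "p \<in> fill_leaves m n ` PK_vec n (u_vec m)" using fill by blast
    qed
  qed
qed


section \<open>Exchanging lucky entries and ones\<close>

text \<open>
  The two maps are meant to be inverse to each other: the first replaces the entry at \<open>i\<close> by a
  \<open>1\<close> at the front, the second replaces a \<open>1\<close> at the front by the lucky value at \<open>i\<close>.
\<close>

definition lucky_to_one :: "nat \<Rightarrow> nat list \<Rightarrow> nat list" where
  "lucky_to_one i p = 1 # take i p @ drop (Suc i) p"

definition one_to_lucky :: "nat \<Rightarrow> nat \<Rightarrow> nat list \<Rightarrow> nat list" where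
  "one_to_lucky m i p = take i (tl p) @ u_vec m i # drop (Suc i) p"

text \<open>
  Index \<open>0\<close> is always lucky and therefore excluded.
\<close>

definition second_lucky :: "nat \<Rightarrow> nat list \<Rightarrow> nat \<Rightarrow> bool" where
  "second_lucky m p i \<longleftrightarrow>
     0 < i \<and> i < length p \<and> p ! i = u_vec m i \<and> (\<forall>k. 0 < k \<and> k < i \<longrightarrow> p ! k < u_vec m k)"

text \<open>
  In a vector parking function this is the least positive index at which \<open>one_to_lucky\<close> keeps
  the list sorted.  The entries \<open>p ! Suc k\<close> with \<open>0 < k < i\<close> then arrive at index \<open>k\<close> without
  being lucky, as \<open>second_lucky\<close> demands.
\<close>

definition insertion_point :: "nat \<Rightarrow> nat list \<Rightarrow> nat \<Rightarrow> bool" where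
  "insertion_point m p i \<longleftrightarrow>
     0 < i \<and> i < length p \<and> (\<forall>k. 0 < k \<and> k < i \<longrightarrow> p ! Suc k < u_vec m k) \<and>
     (Suc i < length p \<longrightarrow> u_vec m i \<le> p ! Suc i)"

lemma length_lucky_to_one: "i < length p \<Longrightarrow> length (lucky_to_one i p) = length p"
  by (simp add: lucky_to_one_def)

lemma length_one_to_lucky: "i < length p \<Longrightarrow> length (one_to_lucky m i p) = length p"
  by (simp add: one_to_lucky_def)

lemma nth_lucky_to_one:
  "i < length p \<Longrightarrow> k < length p \<Longrightarrow>
     lucky_to_one i p ! k = (if k = 0 then 1 else if k \<le> i then p ! (k - 1) else p ! k)"
  by (auto simp: lucky_to_one_def nth_append nth_Cons' min_def)

lemma nth_one_to_lucky:
  "i < length p \<Longrightarrow> k < length p \<Longrightarrow>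
     one_to_lucky m i p ! k = (if k < i then p ! Suc k else if k = i then u_vec m i else p ! k)"
  by (auto simp: one_to_lucky_def nth_append nth_Cons' min_def nth_tl)

lemma u_vec_strict_mono: "m \<ge> 1 \<Longrightarrow> i < j \<Longrightarrow> u_vec m i < u_vec m j"
  by (simp add: u_vec_def)

lemma u_vec_mono: "i \<le> j \<Longrightarrow> u_vec m i \<le> u_vec m j"
  by (simp add: u_vec_def)

lemma u_vec_0 [simp]: "u_vec m 0 = 1"
  by (simp add: u_vec_def)

lemma PK_vec_first: "p \<in> PK_vec n (u_vec m) \<Longrightarrow> n \<ge> 1 \<Longrightarrow> p ! 0 = 1"
  by (force simp: PK_vec_def)

lemma second_lucky_unique: "second_lucky m p i \<Longrightarrow> second_lucky m p j \<Longrightarrow> i = j"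
  unfolding second_lucky_def by (metis less_irrefl linorder_neqE_nat)

lemma insertion_point_unique: "insertion_point m p i \<Longrightarrow> insertion_point m p j \<Longrightarrow> i = j"
  unfolding insertion_point_def
  by (metis Suc_lessI leD linorder_neqE_nat not_less_eq)

lemma ex_second_lucky:
  assumes p: "p \<in> PK_vec n (u_vec m)" and luck: "luck_vec m p \<ge> 2"
  shows "\<exists>i. second_lucky m p i"
proof -
  have "\<not> {i. i < length p \<and> p ! i = u_vec m i} \<subseteq> {0}"
  proof
    assume "{i. i < length p \<and> p ! i = u_vec m i} \<subseteq> {0}"
    then have "luck_vec m p \<le> card {0::nat}"
      unfolding luck_vec_def by (intro card_mono) auto
    then show False using luck by simp
  qed
  then obtain j where "0 < j" "j < length p" "p ! j = u_vec m j" by auto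
  then obtain i where i: "0 < i \<and> i < length p \<and> p ! i = u_vec m i"
    and min: "\<And>k. k < i \<Longrightarrow> \<not> (0 < k \<and> k < length p \<and> p ! k = u_vec m k)"
    using exists_least_iff[of "\<lambda>i. 0 < i \<and> i < length p \<and> p ! i = u_vec m i"] by blast
  have "p ! k < u_vec m k" if "0 < k" "k < i" for k
    using min[of k] that i p by (force simp: PK_vec_def intro: le_neq_implies_less)
  then show ?thesis using i by (auto simp: second_lucky_def)
qed

lemma ex_insertion_point:
  assumes "length p \<ge> 2"
  shows "\<exists>i. insertion_point m p i"
proof -
  let ?P = "\<lambda>i. 0 < i \<and> i < length p \<and> (Suc i < length p \<longrightarrow> u_vec m i \<le> p ! Suc i)"
  have "?P (length p - 1)" using assms by auto
  then obtain i where i: "?P i" and min: "\<And>k. k < i \<Longrightarrow> \<not> ?P k"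
    using exists_least_iff[of ?P] by blast
  have "p ! Suc k < u_vec m k" if "0 < k" "k < i" for k
    using min[of k] that i by auto
  then show ?thesis using i by (auto simp: insertion_point_def)
qed

text \<open>
  The entries before \<open>i\<close> are shifted to places with strictly larger bounds, so none of them is
  lucky any more, and the entries after \<open>i\<close> stay where they are.
\<close>

lemma lucky_to_one_correct:
  assumes m: "m \<ge> 1" and p: "p \<in> PK_vec n (u_vec m)" and i: "second_lucky m p i"
  shows "lucky_to_one i p \<in> PK_vec n (u_vec m)"
    and "Suc (luck_vec m (lucky_to_one i p)) = luck_vec m p"
    and "omega1 (lucky_to_one i p) = Suc (omega1 p)"
    and "insertion_point m (lucky_to_one i p) i"
    and "one_to_lucky m i (lucky_to_one i p) = p"
proof -
  let ?r = "lucky_to_one i p"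
  have len: "length p = n" and srt: "sorted p"
    and bnd: "\<And>k. k < n \<Longrightarrow> 1 \<le> p ! k \<and> p ! k \<le> u_vec m k"
    using p by (auto simp: PK_vec_def)
  have i0: "0 < i" and i_n: "i < n" and pi: "p ! i = u_vec m i"
    and unlucky: "\<And>k. 0 < k \<Longrightarrow> k < i \<Longrightarrow> p ! k < u_vec m k"
    using i len by (auto simp: second_lucky_def)
  have p0: "p ! 0 = 1" using PK_vec_first[OF p] i_n by simp
  have nth_r: "\<And>k. k < n \<Longrightarrow> ?r ! k = (if k = 0 then 1 else if k \<le> i then p ! (k - 1) else p ! k)"
    using nth_lucky_to_one i_n len by simp
  have len_r: "length ?r = n" using length_lucky_to_one i_n len by simp
  have split: "p = take i p @ u_vec m i # drop (Suc i) p"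
    using id_take_nth_drop[of i p] i_n len pi by simp
  have pos: "\<forall>x\<in>set p. 1 \<le> x"
    using bnd len by (metis in_set_conv_nth)
  \<comment> \<open>Here it matters that the bounds increase strictly, which needs \<open>m \<ge> 1\<close>.\<close>
  have shifted: "p ! (k - 1) < u_vec m k" if "0 < k" "k \<le> i" for k
  proof -
    have "p ! (k - 1) \<le> u_vec m (k - 1)" using bnd[of "k - 1"] that i_n by simp
    also have "\<dots> < u_vec m k" using u_vec_strict_mono[OF m, of "k - 1" k] that by simp
    finally show ?thesis .
  qed
  have "sorted ?r"
  proof -
    have "sorted (take i p @ u_vec m i # drop (Suc i) p)" using srt split by simp
    then have "sorted (take i p @ drop (Suc i) p)" by (auto simp: sorted_append)
    moreover have "\<forall>x\<in>set (take i p @ drop (Suc i) p). 1 \<le> x"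
      using pos by (auto dest: in_set_takeD in_set_dropD)
    ultimately show ?thesis by (simp add: lucky_to_one_def)
  qed
  moreover have "1 \<le> ?r ! k \<and> ?r ! k \<le> u_vec m k" if "k < n" for k
    using that bnd[of k] bnd[of "k - 1"] shifted[of k] by (auto simp: nth_r)
  ultimately show "?r \<in> PK_vec n (u_vec m)" using len_r by (simp add: PK_vec_def)
  have "{k. k < length p \<and> p ! k = u_vec m k} = insert i {k. k < length ?r \<and> ?r ! k = u_vec m k}"
    using len len_r i_n pi i0 p0 unlucky shifted
    by (auto simp: nth_r split: if_splits)
       (metis less_irrefl linorder_neqE_nat not_le le_less)+
  moreover have "?r ! i \<noteq> u_vec m i"
    using shifted[of i] i0 i_n by (simp add: nth_r)
  ultimately show "Suc (luck_vec m ?r) = luck_vec m p"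
    by (simp add: luck_vec_def)
  have "u_vec m i \<noteq> 1" using u_vec_strict_mono[OF m i0] by simp
  then have "omega1 p = length (filter (\<lambda>x. x = 1) (take i p)) + length (filter (\<lambda>x. x = 1) (drop (Suc i) p))"
    by (subst split) (simp add: omega1_eq_length_filter)
  then show "omega1 ?r = Suc (omega1 p)"
    by (simp add: omega1_eq_length_filter lucky_to_one_def)
  have "u_vec m i \<le> p ! Suc i" if "Suc i < n"
    using sorted_nth_mono[OF srt, of i "Suc i"] that len pi by simp
  then show "insertion_point m ?r i"
    using i0 i_n unlucky len_r by (auto simp: insertion_point_def nth_r)
  show "one_to_lucky m i ?r = p"
    using len len_r i_n pi by (intro nth_equalityI) (auto simp: length_one_to_lucky nth_one_to_lucky nth_r)
qed

text \<open>
  By the choice of the insertion point the entries shifted to the left respect the smaller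
  bounds and stay unlucky.  This concerns positive indices only; the entry shifted to index \<open>0\<close> is
  admissible because it is \<open>1\<close>.
\<close>

lemma one_to_lucky_correct:
  assumes m: "m \<ge> 1" and p: "p \<in> PK_vec n (u_vec m)" and i: "insertion_point m p i"
    and second: "p ! 1 = 1"
  shows "one_to_lucky m i p \<in> PK_vec n (u_vec m)"
    and "second_lucky m (one_to_lucky m i p) i"
    and "lucky_to_one i (one_to_lucky m i p) = p"
proof -
  let ?r = "one_to_lucky m i p"
  have len: "length p = n" and srt: "sorted p"
    and bnd: "\<And>k. k < n \<Longrightarrow> 1 \<le> p ! k \<and> p ! k \<le> u_vec m k"
    using p by (auto simp: PK_vec_def)
  have i0: "0 < i" and i_n: "i < n"
    and low: "\<And>k. 0 < k \<Longrightarrow> k < i \<Longrightarrow> p ! Suc k < u_vec m k"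
    and high: "Suc i < n \<Longrightarrow> u_vec m i \<le> p ! Suc i"
    using i len by (auto simp: insertion_point_def)
  have p0: "p ! 0 = 1" using PK_vec_first[OF p] i_n by simp
  have nth_r: "\<And>k. k < n \<Longrightarrow> ?r ! k = (if k < i then p ! Suc k else if k = i then u_vec m i else p ! k)"
    using nth_one_to_lucky i_n len by simp
  have len_r: "length ?r = n" using length_one_to_lucky i_n len by simp
  have low': "p ! Suc k \<le> u_vec m k" if "k < i" for k
    using low[of k] second that by (cases "k = 0") auto
  have "sorted ?r"
  proof (subst sorted_iff_nth_Suc, intro allI impI)
    fix k assume k: "Suc k < length ?r"
    consider "Suc k < i" | "Suc k = i" | "k = i" | "k > i" by linarith
    then show "?r ! k \<le> ?r ! Suc k"
    proof cases
      case 1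
      then show ?thesis using k len_r i_n sorted_nth_mono[OF srt, of "Suc k" "Suc (Suc k)"] len
        by (simp add: nth_r)
    next
      case 2
      then show ?thesis using k len_r low'[of k] u_vec_mono[of k i m] by (simp add: nth_r)
    next
      case 3
      then show ?thesis using k len_r high by (simp add: nth_r)
    next
      case 4
      then show ?thesis using k len_r sorted_nth_mono[OF srt, of k "Suc k"] len by (simp add: nth_r)
    qed
  qed
  moreover have "1 \<le> ?r ! k \<and> ?r ! k \<le> u_vec m k" if "k < n" for k
    using that bnd[of k] bnd[of "Suc k"] low'[of k] i_n by (auto simp: nth_r u_vec_def)
  ultimately show "?r \<in> PK_vec n (u_vec m)" using len_r by (simp add: PK_vec_def)
  show "second_lucky m ?r i"
    using i0 i_n len_r low by (auto simp: second_lucky_def nth_r)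
  show "lucky_to_one i ?r = p"
    using len len_r i_n p0
    by (intro nth_equalityI) (auto simp: length_lucky_to_one nth_lucky_to_one nth_r)
qed

definition PK_vec_stats :: "nat \<Rightarrow> nat \<Rightarrow> nat \<Rightarrow> nat \<Rightarrow> nat list set" where
  "PK_vec_stats m n a b = {p \<in> PK_vec n (u_vec m). luck_vec m p = a \<and> omega1 p = b}"

text \<open>
  Both places are unique where they exist.  There is a second lucky entry because
  \<open>luck = a + 1 \<ge> 2\<close>, and the second entry of a list with \<open>\<omega>\<^sub>1 = b + 1 \<ge> 2\<close> is \<open>1\<close>.
\<close>

lemma card_PK_vec_stats_shift:
  assumes m: "m \<ge> 1" and a: "a \<ge> 1" and b: "b \<ge> 1"
  shows "card (PK_vec_stats m n (Suc a) b) = card (PK_vec_stats m n a (Suc b))"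
proof -
  let ?A = "PK_vec_stats m n (Suc a) b" and ?B = "PK_vec_stats m n a (Suc b)"
  let ?f = "\<lambda>p. lucky_to_one (THE i. second_lucky m p i) p"
    and ?g = "\<lambda>p. one_to_lucky m (THE i. insertion_point m p i) p"
  let ?i = "\<lambda>p. THE i. second_lucky m p i" and ?j = "\<lambda>p. THE i. insertion_point m p i"
  have split: "second_lucky m p (?i p)" if "p \<in> ?A" for p
    using that a ex_second_lucky[of p n m] second_lucky_unique
    by (auto simp: PK_vec_stats_def intro: theI)
  have the_i: "?i p = i" if "second_lucky m p i" for p i
    using that second_lucky_unique by blast
  have the_j: "?j p = i" if "insertion_point m p i" for p i
    using that insertion_point_unique by blast
  have second: "insertion_point m p (?j p) \<and> p ! 1 = 1" if "p \<in> ?B" for p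
  proof -
    have p: "p \<in> PK_vec n (u_vec m)" and w: "omega1 p \<ge> 2"
      using that b by (auto simp: PK_vec_stats_def)
    have "\<not> {i. i < length p \<and> p ! i = 1} \<subseteq> {0}"
    proof
      assume "{i. i < length p \<and> p ! i = 1} \<subseteq> {0}"
      then have "omega1 p \<le> card {0::nat}"
        unfolding omega1_def by (intro card_mono) auto
      then show False using w by simp
    qed
    then obtain k where k: "0 < k" "k < length p" "p ! k = 1" by auto
    then have "p ! 1 \<le> 1" "1 \<le> p ! 1"
      using p sorted_nth_mono[of p 1 k] by (auto simp: PK_vec_def)
    moreover have "\<exists>i. insertion_point m p i"
      using k by (intro ex_insertion_point) simp
    ultimately show ?thesis using the_j by auto
  qed
  have in_PK: "p \<in> PK_vec n (u_vec m)" if "p \<in> ?A \<or> p \<in> ?B" for p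
    using that by (auto simp: PK_vec_stats_def)
  have inv_A: "\<forall>p\<in>?A. ?g (?f p) = p"
  proof
    fix p assume p: "p \<in> ?A"
    note correct = lucky_to_one_correct(4,5)[OF m in_PK[OF disjI1[OF p]] split[OF p]]
    show "?g (?f p) = p" using the_j[OF correct(1)] correct(2) by simp
  qed
  have inv_B: "\<forall>p\<in>?B. ?f (?g p) = p"
  proof
    fix p assume p: "p \<in> ?B"
    note correct = one_to_lucky_correct(2,3)[OF m in_PK[OF disjI2[OF p]]
      conjunct1[OF second[OF p]] conjunct2[OF second[OF p]]]
    show "?f (?g p) = p" using the_i[OF correct(1)] correct(2) by simp
  qed
  have im_A: "?f ` ?A \<subseteq> ?B"
  proof
    fix r assume "r \<in> ?f ` ?A"
    then obtain p where "p \<in> ?A" "r = lucky_to_one (?i p) p" by blast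
    then show "r \<in> ?B"
      using lucky_to_one_correct(1-3)[OF m _ split, of p] by (auto simp: PK_vec_stats_def)
  qed
  have im_B: "?g ` ?B \<subseteq> ?A"
  proof
    fix r assume "r \<in> ?g ` ?B"
    then obtain p where p: "p \<in> ?B" and r: "r = one_to_lucky m (?j p) p" by blast
    then have "p \<in> PK_vec n (u_vec m)" by (simp add: PK_vec_stats_def)
    note low = one_to_lucky_correct[OF m this conjunct1[OF second[OF p]] conjunct2[OF second[OF p]]]
    show "r \<in> ?A"
      using lucky_to_one_correct(2,3)[OF m low(1,2)] low p r by (auto simp: PK_vec_stats_def)
  qed
  show ?thesis
    using bij_betw_byWitness[OF inv_A inv_B im_A im_B] by (rule bij_betw_same_card)
qed

lemma card_PK_vec_stats:
  assumes "m \<ge> 1" "a \<ge> 1" "b \<ge> 1"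
  shows "card (PK_vec_stats m n a b) = card (PK_vec_stats m n (a + b - 1) 1)"
  using \<open>b \<ge> 1\<close> \<open>a \<ge> 1\<close>
proof (induction b arbitrary: a rule: dec_induct)
  case (step b)
  then show ?case using card_PK_vec_stats_shift[OF \<open>m \<ge> 1\<close>, of a b n] by simp
qed simp

lemma stats_pos:
  assumes "n \<ge> 1" "p \<in> PK_vec n (u_vec m)"
  shows "luck_vec m p \<ge> 1" "omega1 p \<ge> 1"
proof -
  have "p ! 0 = 1" "length p = n" using assms PK_vec_first by (auto simp: PK_vec_def)
  then have "{0} \<subseteq> {i. i < length p \<and> p ! i = u_vec m i}" "{0} \<subseteq> {i. i < length p \<and> p ! i = 1}"
    using assms by auto
  then have "card {0::nat} \<le> luck_vec m p" "card {0::nat} \<le> omega1 p"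
    unfolding luck_vec_def omega1_def by (intro card_mono; simp)+
  then show "luck_vec m p \<ge> 1" "omega1 p \<ge> 1" by simp_all
qed

lemma card_PK_vec_stats_sym:
  assumes "m \<ge> 1" "n \<ge> 1"
  shows "card (PK_vec_stats m n a b) = card (PK_vec_stats m n b a)"
proof (cases "a \<ge> 1 \<and> b \<ge> 1")
  case True
  then show ?thesis using assms card_PK_vec_stats by (metis add.commute)
next
  case False
  then have "PK_vec_stats m n a b = {}" "PK_vec_stats m n b a = {}"
    using stats_pos[OF assms(2)] by (force simp: PK_vec_stats_def)+
  then show ?thesis by simp
qed

text \<open>
  Lists with \<open>luck = a\<close> and \<open>\<omega>\<^sub>1 = b\<close> are grouped by \<open>k = a + b - 2\<close> and \<open>s = b - 1\<close>.  Both
  statistics are positive and at most \<open>n\<close>, so \<open>k \<le> 2 n\<close>.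
\<close>

lemma gamma_sum_eq:
  fixes q t :: "'a::comm_ring_1"
  assumes m: "m \<ge> 1" and n: "n \<ge> 1"
  shows "gamma_sum m n q t =
           q * t * (\<Sum>k\<le>2 * n. of_int (int (card (PK_vec_stats m n (Suc k) 1))) * hsym k q t)"
proof -
  let ?P = "PK_vec n (u_vec m)"
  let ?I = "SIGMA k:{..2 * n}. {0..k}"
  let ?S = "\<lambda>(k, s). PK_vec_stats m n (Suc (k - s)) (Suc s)"
  let ?w = "\<lambda>p. q ^ luck_vec m p * t ^ omega1 p"
  have cover: "?P = (\<Union>x\<in>?I. ?S x)"
  proof
    show "?P \<subseteq> (\<Union>x\<in>?I. ?S x)"
    proof
      fix p assume p: "p \<in> ?P"
      then have "length p = n" by (simp add: PK_vec_def)
      moreover have "luck_vec m p \<le> length p" "omega1 p \<le> length p"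
        unfolding luck_vec_def omega1_def by (auto intro!: card_mono[of "{..<length p}", simplified])
      ultimately have "(luck_vec m p + omega1 p - 2, omega1 p - 1) \<in> ?I \<and>
          p \<in> ?S (luck_vec m p + omega1 p - 2, omega1 p - 1)"
        using stats_pos[OF n p] p by (auto simp: PK_vec_stats_def)
      then show "p \<in> (\<Union>x\<in>?I. ?S x)" by blast
    qed
  qed (auto simp: PK_vec_stats_def)
  have "gamma_sum m n q t = (\<Sum>x\<in>?I. \<Sum>p\<in>?S x. ?w p)"
    unfolding gamma_sum_def cover
    by (rule sum.UNION_disjoint)
       (auto simp: PK_vec_stats_def intro: finite_subset[OF _ finite_PK_vec])
  also have "\<dots> = (\<Sum>(k, s)\<in>?I. of_int (int (card (PK_vec_stats m n (Suc k) 1))) *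
                   (q * t * (q ^ (k - s) * t ^ s)))"
  proof (rule sum.cong[OF refl])
    fix x assume "x \<in> ?I"
    then obtain k s where x: "x = (k, s)" "s \<in> {0..k}" by auto
    then have "card (?S (k, s)) = card (PK_vec_stats m n (Suc k) 1)"
      using card_PK_vec_stats[OF m, of "Suc (k - s)" "Suc s" n] by simp
    moreover have "(\<Sum>p\<in>?S (k, s). ?w p) = of_nat (card (?S (k, s))) * (q ^ Suc (k - s) * t ^ Suc s)"
      by (simp add: PK_vec_stats_def)
    ultimately show "(\<Sum>p\<in>?S x. ?w p) = (case x of (k, s) \<Rightarrow>
        of_int (int (card (PK_vec_stats m n (Suc k) 1))) * (q * t * (q ^ (k - s) * t ^ s)))"
      by (simp add: x algebra_simps)
  qed
  also have "\<dots> = q * t * (\<Sum>k\<le>2 * n. of_int (int (card (PK_vec_stats m n (Suc k) 1))) * hsym k q t)"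
    by (simp add: sum.Sigma[symmetric] hsym_def sum_distrib_left algebra_simps)
  finally show ?thesis .
qed


section \<open>Symmetry on the caterpillar\<close>

lemma card_PK_cat_stats:
  assumes m: "m \<ge> 1" and n: "n \<ge> 1"
  shows "card {p \<in> PK_cat m n. luck_cat m n p = a \<and> omega1 p = b} = card (PK_vec_stats m n a b)"
proof -
  have "{p \<in> PK_cat m n. luck_cat m n p = a \<and> omega1 p = b} = fill_leaves m n ` PK_vec_stats m n a b"
    using bij_betw_imp_surj_on[OF bij_betw_fill_leaves[OF m n], symmetric]
      luck_cat_fill_leaves[OF m n] omega1_fill_leaves[OF n]
    by (auto simp: PK_vec_stats_def)
  moreover have "inj_on (fill_leaves m n) (PK_vec_stats m n a b)"
    using bij_betw_fill_leaves[OF m n] unfolding bij_betw_def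
    by (auto simp: PK_vec_stats_def intro: inj_on_subset)
  ultimately show ?thesis by (simp add: card_image)
qed

theorem corollary2:
  fixes m n :: nat
  assumes "m \<ge> 1" and "n \<ge> 1"
  shows "(\<forall>a b :: int.
            card {p \<in> PK_cat m n. int (luck_cat m n p) = a \<and> int (omega1 p) = b} =
            card {p \<in> PK_cat m n. int (luck_cat m n p) = b \<and> int (omega1 p) = a})
       \<and> var_q * var_t dvd gamma_sum m n var_q var_t
       \<and> (\<exists>(K :: nat) (c :: nat \<Rightarrow> int).
            gamma_sum m n var_q var_t div (var_q * var_t) =
              (\<Sum>k\<le>K. of_int (c k) * hsym k var_q var_t))"
proof (intro conjI allI)
  fix a b :: int
  show "card {p \<in> PK_cat m n. int (luck_cat m n p) = a \<and> int (omega1 p) = b} =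
        card {p \<in> PK_cat m n. int (luck_cat m n p) = b \<and> int (omega1 p) = a}"
  proof (cases "a \<ge> 0 \<and> b \<ge> 0")
    case True
    then obtain a' b' where ab: "a = int a'" "b = int b'" by (meson nonneg_int_cases)
    show ?thesis
      unfolding ab of_nat_eq_iff card_PK_cat_stats[OF assms] by (rule card_PK_vec_stats_sym[OF assms])
  next
    case False
    then have "{p \<in> PK_cat m n. int (luck_cat m n p) = a \<and> int (omega1 p) = b} = {}"
      "{p \<in> PK_cat m n. int (luck_cat m n p) = b \<and> int (omega1 p) = a} = {}" by auto
    then show ?thesis by (simp only: card.empty)
  qed
next
  note gamma = gamma_sum_eq[OF assms, of var_q var_t]
  show "var_q * var_t dvd gamma_sum m n var_q var_t"
    unfolding gamma by (rule dvd_triv_left)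
  have "var_q * var_t \<noteq> 0" by (simp add: var_q_def var_t_def)
  then show "\<exists>(K :: nat) (c :: nat \<Rightarrow> int).
      gamma_sum m n var_q var_t div (var_q * var_t) =
        (\<Sum>k\<le>K. of_int (c k) * hsym k var_q var_t)"
    unfolding gamma by (intro exI) (rule nonzero_mult_div_cancel_left)
qed

end
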